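(* Let $n\geq 5$ and let $\lambda_2,\ldots,\lambda_n$ be real numbers with $1\geq\lambda_2\geq\cdots\geq\lambda_n\geq -1$ and $1+\lambda_2+\cdots+\lambda_n\geq 0$. If $$\frac{1}{n}+\sum_{k=2}^{n-3}\frac{\lambda_k}{(n-k+2)(n-k+1)}+\frac{\lambda_{n-2}}{4}+\frac{\lambda_{n-1}}{4}+\frac{\lambda_n}{4}\geq 0$$ and $$\frac{1}{n}+\sum_{k=2}^{n-3}\frac{\lambda_k}{(n-k+2)(n-k+1)}-\frac{\lambda_{n-2}}{4}-\frac{\lambda_{n-1}}{4}+\frac{\lambda_n}{4}\geq 0,$$ then there is an $n\times n$ symmetric doubly stochastic matrix $D$ with eigenvalues $1,\lambda_2,\ldots,\lambda_n$.
   Context: An $n\times n$ real matrix is doubly stochastic if all its entries are nonnegative and each row sum and each column sum equals $1$. Eigenvalues are counted with algebraic multiplicity. The sum is $\frac{\lambda_2}{n(n-1)}+\frac{\lambda_3}{(n-1)(n-2)}+\cdots+\frac{\lambda_{n-3}}{20}$. *)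

theory Defs
  imports "Jordan_Normal_Form.Char_Poly"
begin

definition doubly_stochastic :: "nat \<Rightarrow> real mat \<Rightarrow> bool" where
  "doubly_stochastic n A \<longleftrightarrow> A \<in> carrier_mat n n \<and>
     (\<forall>i<n. \<forall>j<n. A $$ (i, j) \<ge> 0) \<and>
     (\<forall>i<n. (\<Sum>j<n. A $$ (i, j)) = 1) \<and>
     (\<forall>j<n. (\<Sum>i<n. A $$ (i, j)) = 1)"

definition symmetric_matrix :: "real mat \<Rightarrow> bool" where
  "symmetric_matrix A \<longleftrightarrow> transpose_mat A = A"

text \<open>The real eigenvalues counted with algebraic multiplicity, i.e. with their multiplicity
  as roots of the characteristic polynomial. If this multiset has as many elements as the
  matrix has rows, then there are no further (non-real) eigenvalues.\<close>
definition eigenvalue_mset :: "real mat \<Rightarrow> real multiset" where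
  "eigenvalue_mset A = proots (char_poly A)"

end

theory Submission
  imports Defs
begin

text \<open>
  The matrix is written down by its spectral decomposition. Put \<open>n = q + 4\<close> and renumber the
  eigenvalues as \<open>\<mu> 0 = 1 \<ge> \<mu> 1 \<ge> \<dots> \<ge> \<mu> (n - 1)\<close>. As eigenvectors take the all-ones vector,
  the Soules vectors \<open>(0, \<dots>, 0, m - 1, -1, \<dots>, -1)\<close> with \<open>m = n, n - 1, \<dots>, 5\<close> nonzero entries,
  and three vectors that live on the last four coordinates and are there the nonconstant rows of a
  Hadamard matrix of order four. They are pairwise orthogonal, so the matrix
  \<open>D = (\<Sum>k. \<mu> k * w\<^sub>k w\<^sub>k\<^sup>T / |w\<^sub>k|\<^sup>2)\<close> is symmetric with the prescribed spectrum, and its rows and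
  columns sum to \<open>1\<close> because the all-ones vector is an eigenvector for \<open>\<mu> 0 = 1\<close>
  (lemmas \<open>proots_char_poly_spectral_mat\<close> and \<open>spectral_mat_row_sum\<close>).

  It remains to see that the entries are nonnegative. Let \<open>T k\<close> be the sum of \<open>\<mu> l / |w\<^sub>l|\<^sup>2\<close>
  over \<open>l < k\<close>.
  An off-diagonal entry in one of the first \<open>q\<close> rows or columns is \<open>T k - \<mu> k / m\<close>, where
  \<open>m\<close> is the support size of \<open>w\<^sub>k\<close>; since \<open>\<mu>\<close> decreases and the weights in \<open>T k\<close> telescope to
  \<open>1 / m\<close>, this is nonnegative without any further assumption (\<open>soules_partial_sum_ge\<close>). The
  diagonal entries weakly decrease along the diagonal (\<open>soules_diag_ge\<close>), and the last one is
  nonnegative by the first of the two inequalities. The off-diagonal entries of the last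
  \<open>4 \<times> 4\<close> block are \<open>T (q + 1) + (\<plusminus>\<mu> (q + 1) \<plusminus> \<mu> (q + 2) \<plusminus> \<mu> (q + 3)) / 4\<close> with exactly two minus
  signs; as \<open>\<mu>\<close> decreases, the smallest is the one bounded by the second inequality.
\<close>

section \<open>Matrices given by an orthogonal eigenbasis\<close>

text \<open>The matrix with eigenvectors \<open>w k\<close> and eigenvalues \<open>\<mu> k\<close>, where \<open>c k\<close> is the squared norm
  of \<open>w k\<close>. Keeping the squared norms apart avoids square roots.\<close>
definition spectral_mat ::
    "nat \<Rightarrow> (nat \<Rightarrow> real) \<Rightarrow> (nat \<Rightarrow> nat \<Rightarrow> real) \<Rightarrow> (nat \<Rightarrow> real) \<Rightarrow> real mat" where
  "spectral_mat n \<mu> w c = mat n n (\<lambda>(i, j). \<Sum>k<n. \<mu> k / c k * (w k i * w k j))"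

lemma spectral_mat_carrier [simp]: "spectral_mat n \<mu> w c \<in> carrier_mat n n"
  by (simp add: spectral_mat_def)

lemma dim_spectral_mat [simp]:
  "dim_row (spectral_mat n \<mu> w c) = n" "dim_col (spectral_mat n \<mu> w c) = n"
  by (simp_all add: spectral_mat_def)

lemma spectral_mat_index:
  "i < n \<Longrightarrow> j < n \<Longrightarrow> spectral_mat n \<mu> w c $$ (i, j) = (\<Sum>k<n. \<mu> k / c k * (w k i * w k j))"
  by (simp add: spectral_mat_def)

lemma spectral_mat_sym:
  "i < n \<Longrightarrow> j < n \<Longrightarrow> spectral_mat n \<mu> w c $$ (j, i) = spectral_mat n \<mu> w c $$ (i, j)"
  by (simp add: spectral_mat_index mult.commute)

lemma symmetric_spectral_mat: "symmetric_matrix (spectral_mat n \<mu> w c)"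
  unfolding symmetric_matrix_def
  by (rule eq_matI) (simp_all add: spectral_mat_sym)

lemma proots_char_poly_spectral_mat:
  fixes w :: "nat \<Rightarrow> nat \<Rightarrow> real"
  assumes orth: "\<And>k l. k < n \<Longrightarrow> l < n \<Longrightarrow> (\<Sum>i<n. w k i * w l i) = (if k = l then c k else 0)"
    and c: "\<And>k. k < n \<Longrightarrow> c k \<noteq> 0"
  shows "proots (char_poly (spectral_mat n \<mu> w c)) = image_mset \<mu> (mset_set {..<n})"
proof -
  let ?D = "spectral_mat n \<mu> w c"
  define P where "P = mat n n (\<lambda>(i, k). w k i)"
  define Q where "Q = mat n n (\<lambda>(k, i). w k i / c k)"
  define L where "L = mat_diag n \<mu>"
  have carr: "P \<in> carrier_mat n n" "Q \<in> carrier_mat n n" "L \<in> carrier_mat n n"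
    by (auto simp: P_def Q_def L_def)
  have QP: "Q * P = 1\<^sub>m n"
  proof (rule eq_matI)
    fix k l assume "k < dim_row (1\<^sub>m n)" "l < dim_col (1\<^sub>m n)"
    then have kl: "k < n" "l < n" by auto
    have "(Q * P) $$ (k, l) = (\<Sum>i<n. w k i / c k * w l i)"
      using kl by (simp add: P_def Q_def scalar_prod_def atLeast0LessThan)
    also have "\<dots> = (\<Sum>i<n. w k i * w l i) / c k"
      by (simp add: sum_divide_distrib)
    also have "\<dots> = 1\<^sub>m n $$ (k, l)"
      using kl orth[OF kl] c[of k] by auto
    finally show "(Q * P) $$ (k, l) = 1\<^sub>m n $$ (k, l)" .
  qed (use carr in auto)
  then have PQ: "P * Q = 1\<^sub>m n"
    using carr mat_mult_left_right_inverse by blast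
  have "?D = P * L * Q"
  proof (rule eq_matI)
    fix i j assume "i < dim_row (P * L * Q)" "j < dim_col (P * L * Q)"
    then have ij: "i < n" "j < n" using carr by auto
    have "P * L = mat n n (\<lambda>(i, k). w k i * \<mu> k)"
      unfolding L_def by (subst mat_diag_mult_right[of _ n]) (auto simp: P_def)
    then have "(P * L * Q) $$ (i, j) = (\<Sum>k<n. w k i * \<mu> k * (w k j / c k))"
      using ij by (simp add: Q_def scalar_prod_def atLeast0LessThan)
    then show "?D $$ (i, j) = (P * L * Q) $$ (i, j)"
      using ij by (simp add: spectral_mat_index mult_ac)
  qed (use carr in auto)
  then have "similar_mat_wit ?D L P Q"
    using carr PQ QP by (simp add: similar_mat_wit_def Let_def)
  then have "similar_mat ?D L"
    by (auto simp: similar_mat_def)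
  then have "char_poly ?D = (\<Prod>a\<leftarrow>diag_mat L. [:- a, 1:])"
    using carr(3) by (simp add: char_poly_similar)
      (rule char_poly_upper_triangular, auto simp: L_def mat_diag_def)
  also have "\<dots> = (\<Prod>k<n. [:- \<mu> k, 1:])"
    by (simp add: diag_mat_def L_def mat_diag_def o_def atLeast0LessThan
        prod.distinct_set_conv_list [symmetric] cong: map_cong)
  finally show ?thesis
    by (simp add: proots_prod sum_unfold_sum_mset)
qed

lemma spectral_mat_row_sum:
  assumes orth: "\<And>k. k < n \<Longrightarrow> (\<Sum>j<n. w k j) = (if k = 0 then c 0 else 0)"
    and c: "c 0 \<noteq> 0" and w0: "w 0 i = 1" and \<mu>0: "\<mu> 0 = 1" and i: "i < n"
  shows "(\<Sum>j<n. spectral_mat n \<mu> w c $$ (i, j)) = 1"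
proof -
  have "(\<Sum>j<n. spectral_mat n \<mu> w c $$ (i, j)) = (\<Sum>j<n. \<Sum>k<n. \<mu> k / c k * (w k i * w k j))"
    using i by (simp add: spectral_mat_index)
  also have "\<dots> = (\<Sum>k<n. \<mu> k / c k * w k i * (\<Sum>j<n. w k j))"
    by (subst sum.swap) (simp add: sum_distrib_left mult.assoc)
  also have "\<dots> = (\<Sum>k<n. if k = 0 then 1 else 0)"
    by (rule sum.cong) (use orth c w0 \<mu>0 in auto)
  also have "\<dots> = 1" using i by simp
  finally show ?thesis .
qed

section \<open>The orthogonal system of Soules and Hadamard vectors\<close>

text \<open>The eigenvectors in dimension \<open>q + 4\<close>: the all-ones vector for \<open>k = 0\<close>; for \<open>1 \<le> k \<le> q\<close> the
  Soules vector with first nonzero coordinate \<open>k - 1\<close>; and for \<open>k = q + 1, q + 2, q + 3\<close> a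
  Hadamard row on the coordinates \<open>q, \<dots>, q + 3\<close>, with its two positive signs at \<open>q\<close> and \<open>k\<close>.\<close>
definition soules :: "nat \<Rightarrow> nat \<Rightarrow> nat \<Rightarrow> real" where
  "soules q k i =
     (if k = 0 then 1
      else if k \<le> q then (if i < k - 1 then 0 else if i = k - 1 then real q + 4 - real k else -1)
      else (if i < q then 0 else if i = q \<or> i = k then 1 else -1))"

text \<open>The squared norms of the vectors \<open>soules q k\<close>.\<close>
definition soules_norm :: "nat \<Rightarrow> nat \<Rightarrow> real" where
  "soules_norm q k =
     (if k = 0 then real q + 4
      else if k \<le> q then (real q + 5 - real k) * (real q + 4 - real k) else 4)"

lemma soules_norm_nonzero: "soules_norm q k \<noteq> 0"
  by (auto simp: soules_norm_def)

lemma sum_lessThan_add4: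
  fixes f :: "nat \<Rightarrow> real"
  shows "(\<Sum>i<q + 4. f i) = (\<Sum>i<q. f i) + f q + f (q + 1) + f (q + 2) + f (q + 3)"
  by (simp add: numeral_eq_Suc)

lemma sum_lessThan_split:
  fixes f :: "nat \<Rightarrow> real"
  assumes "p < n"
  shows "(\<Sum>i<n. f i) = (\<Sum>i<p. f i) + f p + (\<Sum>i\<in>{p<..<n}. f i)"
proof -
  have "{..<n} = {..<p} \<union> insert p {p<..<n}"
    using assms by auto
  moreover have "{..<p} \<inter> insert p {p<..<n} = {}"
    by auto
  ultimately show ?thesis
    by (simp add: sum.union_disjoint)
qed

lemma sum_eventually_constant:
  fixes f :: "nat \<Rightarrow> real"
  assumes "p < n" and "\<And>i. i < p \<Longrightarrow> f i = 0" and "\<And>i. p < i \<Longrightarrow> i < n \<Longrightarrow> f i = b"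
  shows "(\<Sum>i<n. f i) = f p + (real n - real p - 1) * b"
proof -
  have "(\<Sum>i<n. f i) = (\<Sum>i<p. f i) + f p + (\<Sum>i\<in>{p<..<n}. f i)"
    by (rule sum_lessThan_split) (rule assms(1))
  also have "\<dots> = f p + (\<Sum>i\<in>{p<..<n}. b)"
    using assms(2,3) by simp
  finally show ?thesis
    using assms(1) by (simp add: of_nat_diff)
qed

lemma sum_soules:
  assumes "k < q + 4"
  shows "(\<Sum>i<q + 4. soules q k i) = (if k = 0 then real q + 4 else 0)"
proof -
  consider "k = 0" | "1 \<le> k" "k \<le> q" | "k = q + 1 \<or> k = q + 2 \<or> k = q + 3"
    using assms by linarith
  then show ?thesis
  proof cases
    case 1
    then show ?thesis by (simp add: soules_def)
  next
    case 2
    then show ?thesis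
      by (subst sum_eventually_constant[where p = "k - 1" and b = "-1"])
        (auto simp: soules_def of_nat_diff)
  next
    case 3
    then show ?thesis
      unfolding sum_lessThan_add4 by (auto simp: soules_def)
  qed
qed

lemma sum_soules_square:
  assumes "k < q + 4"
  shows "(\<Sum>i<q + 4. soules q k i * soules q k i) = soules_norm q k"
proof -
  consider "k = 0" | "1 \<le> k" "k \<le> q" | "k = q + 1 \<or> k = q + 2 \<or> k = q + 3"
    using assms by linarith
  then show ?thesis
  proof cases
    case 1
    then show ?thesis by (simp add: soules_def soules_norm_def)
  next
    case 2
    then show ?thesis
      by (subst sum_eventually_constant[where p = "k - 1" and b = 1])
        (auto simp: soules_def soules_norm_def of_nat_diff algebra_simps)
  next
    case 3
    then show ?thesis
      unfolding sum_lessThan_add4 by (auto simp: soules_def soules_norm_def)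
  qed
qed

lemma sum_soules_mult_less:
  assumes kl: "k < l" "l < q + 4"
  shows "(\<Sum>i<q + 4. soules q k i * soules q l i) = 0"
proof (cases "k \<le> q")
  case True
  \<comment> \<open>The earlier vector is constant on the support of the later one, whose entries sum to zero.\<close>
  have "soules q k i * soules q l i = (if k = 0 then 1 else -1) * soules q l i" for i
    using kl True by (auto simp: soules_def)
  then have "(\<Sum>i<q + 4. soules q k i * soules q l i) =
      (if k = 0 then 1 else -1) * (\<Sum>i<q + 4. soules q l i)"
    by (simp only: sum_distrib_left)
  then show ?thesis
    using kl sum_soules[of l q] by simp
next
  case False
  then have "k = q + 1 \<and> (l = q + 2 \<or> l = q + 3) \<or> k = q + 2 \<and> l = q + 3"
    using kl by linarith
  then show ?thesis
    unfolding sum_lessThan_add4 by (elim disjE conjE) (simp_all add: soules_def)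
qed

lemma soules_orthogonal:
  assumes "k < q + 4" "l < q + 4"
  shows "(\<Sum>i<q + 4. soules q k i * soules q l i) = (if k = l then soules_norm q k else 0)"
  using assms sum_soules_square[of k q] sum_soules_mult_less[of k l q] sum_soules_mult_less[of l k q]
  by (cases k l rule: linorder_cases) (auto simp: mult.commute)

section \<open>Nonnegativity of the entries\<close>

text \<open>For \<open>k \<le> q + 1\<close>, the contribution of the first \<open>k\<close> eigenvectors to every entry whose row and
  column are at least \<open>k - 1\<close>: each of these eigenvectors is constantly \<open>1\<close> or constantly \<open>-1\<close>
  there.\<close>
definition soules_partial_sum :: "nat \<Rightarrow> (nat \<Rightarrow> real) \<Rightarrow> nat \<Rightarrow> real" where
  "soules_partial_sum q \<mu> k = (\<Sum>l<k. \<mu> l / soules_norm q l)"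

text \<open>In row \<open>i < q\<close> the eigenvectors beyond number \<open>i + 1\<close> vanish, and number \<open>i + 1\<close> itself
  contributes the summand after the partial sum.\<close>
lemma soules_entry_first:
  assumes "i < q" "i \<le> j" "j < q + 4"
  shows "(\<Sum>k<q + 4. \<mu> k / soules_norm q k * (soules q k i * soules q k j)) =
    soules_partial_sum q \<mu> (i + 1) +
    (if i = j then \<mu> (i + 1) * (real q + 3 - real i) / (real q + 4 - real i)
     else - \<mu> (i + 1) / (real q + 4 - real i))"
proof -
  let ?f = "\<lambda>k. \<mu> k / soules_norm q k * (soules q k i * soules q k j)"
  have "(\<Sum>k<q + 4. ?f k) = (\<Sum>k<i + 1. ?f k) + ?f (i + 1) + (\<Sum>k\<in>{i + 1<..<q + 4}. ?f k)"
    by (rule sum_lessThan_split) (use assms in simp)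
  moreover have "(\<Sum>k<i + 1. ?f k) = soules_partial_sum q \<mu> (i + 1)"
    unfolding soules_partial_sum_def
    by (rule sum.cong) (use assms in \<open>auto simp: soules_def\<close>)
  moreover have "(\<Sum>k\<in>{i + 1<..<q + 4}. ?f k) = 0"
    by (rule sum.neutral) (use assms in \<open>auto simp: soules_def\<close>)
  moreover have "?f (i + 1) =
      (if i = j then \<mu> (i + 1) * (real q + 3 - real i) / (real q + 4 - real i)
       else - \<mu> (i + 1) / (real q + 4 - real i))"
  proof -
    define r where "r = real q + 3 - real i"
    have "r > 0" using assms by (simp add: r_def)
    moreover have q: "real q + 4 - real i = r + 1" "real q + 3 - real i = r"
      by (simp_all add: r_def)
    moreover have "soules_norm q (i + 1) = (r + 1) * r" "soules q (i + 1) i = r"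
        "soules q (i + 1) j = (if i = j then r else -1)"
      using assms by (auto simp: soules_def soules_norm_def r_def)
    ultimately show ?thesis
      unfolding q by simp
  qed
  ultimately show ?thesis by simp
qed

lemma soules_entry_last:
  assumes "q \<le> i" "i < q + 4" "q \<le> j" "j < q + 4"
  shows "(\<Sum>k<q + 4. \<mu> k / soules_norm q k * (soules q k i * soules q k j)) =
    soules_partial_sum q \<mu> (q + 1) +
    (\<mu> (q + 1) * (soules q (q + 1) i * soules q (q + 1) j) +
     \<mu> (q + 2) * (soules q (q + 2) i * soules q (q + 2) j) +
     \<mu> (q + 3) * (soules q (q + 3) i * soules q (q + 3) j)) / 4"
proof -
  let ?f = "\<lambda>k. \<mu> k / soules_norm q k * (soules q k i * soules q k j)"
  have "(\<Sum>k<q + 4. ?f k) = (\<Sum>k<q + 1. ?f k) + ?f (q + 1) + ?f (q + 2) + ?f (q + 3)"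
    by (simp add: numeral_eq_Suc)
  moreover have "(\<Sum>k<q + 1. ?f k) = soules_partial_sum q \<mu> (q + 1)"
    unfolding soules_partial_sum_def
    by (rule sum.cong) (use assms in \<open>auto simp: soules_def\<close>)
  ultimately show ?thesis
    by (simp add: soules_norm_def add_divide_distrib)
qed

text \<open>Nonnegativity of the off-diagonal entries in row \<open>k < q\<close>. The induction step uses
  \<open>1 / m + 1 / (m * (m - 1)) = 1 / (m - 1)\<close> for the support size \<open>m = q + 4 - k\<close>.\<close>
lemma soules_partial_sum_ge:
  assumes dec: "\<And>k. k < q + 3 \<Longrightarrow> \<mu> (Suc k) \<le> \<mu> k" and "k < q"
  shows "soules_partial_sum q \<mu> (k + 1) \<ge> \<mu> (k + 1) / (real q + 4 - real k)"
  using \<open>k < q\<close>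
proof (induction k)
  case 0
  then show ?case
    using dec[of 0] by (simp add: soules_partial_sum_def soules_norm_def divide_right_mono)
next
  case (Suc k)
  have "\<mu> (k + 2) / (real q + 3 - real k) \<le> \<mu> (k + 1) / (real q + 3 - real k)"
    using dec[of "k + 1"] Suc.prems by (intro divide_right_mono) auto
  also have "\<dots> = \<mu> (k + 1) / (real q + 4 - real k) + \<mu> (k + 1) / soules_norm q (k + 1)"
    using Suc.prems by (simp add: soules_norm_def divide_simps) (simp add: algebra_simps)
  also have "\<dots> \<le> soules_partial_sum q \<mu> (k + 1) + \<mu> (k + 1) / soules_norm q (k + 1)"
    using Suc by simp
  also have "\<dots> = soules_partial_sum q \<mu> (k + 2)"
    by (simp add: soules_partial_sum_def)
  finally show ?case by (simp add: algebra_simps)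
qed

text \<open>Every diagonal entry in the first \<open>q\<close> rows is at least the common diagonal entry of the
  last four rows. The induction runs upwards along the diagonal, comparing neighbours.\<close>
lemma soules_diag_ge:
  assumes dec: "\<And>k. k < q + 3 \<Longrightarrow> \<mu> (Suc k) \<le> \<mu> k" and "k < q"
  shows "soules_partial_sum q \<mu> (q + 1) + (\<mu> (q + 1) + \<mu> (q + 2) + \<mu> (q + 3)) / 4 \<le>
    soules_partial_sum q \<mu> (k + 1) + \<mu> (k + 1) * (real q + 3 - real k) / (real q + 4 - real k)"
proof -
  from \<open>k < q\<close> have "k \<le> q - 1" by simp
  then show ?thesis
  proof (induction rule: inc_induct)
    case base
    have "\<mu> (q + 1) \<le> \<mu> q" "\<mu> (q + 2) \<le> \<mu> q" "\<mu> (q + 3) \<le> \<mu> q"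
      using dec[of q] dec[of "q + 1"] dec[of "q + 2"] by (auto simp: numeral_eq_Suc)
    then have "(\<mu> (q + 1) + \<mu> (q + 2) + \<mu> (q + 3)) / 4 \<le> 3 / 4 * \<mu> q"
      by simp
    moreover have "soules_partial_sum q \<mu> (q + 1) = soules_partial_sum q \<mu> q + \<mu> q / 20"
      using \<open>k < q\<close> by (simp add: soules_partial_sum_def soules_norm_def)
    moreover have q: "q - 1 + 1 = q" "real q + 3 - real (q - 1) = 4" "real q + 4 - real (q - 1) = 5"
      using \<open>k < q\<close> by (simp_all add: of_nat_diff)
    ultimately show ?case
      unfolding q by linarith
  next
    case (step m)
    define r where "r = real q - real m"
    have r: "r > 1" using step.hyps by (simp add: r_def)
    have "\<mu> (m + 2) \<le> \<mu> (m + 1)"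
      using dec[of "m + 1"] step.hyps by simp
    then have "\<mu> (m + 2) * (r + 2) / (r + 3) \<le> \<mu> (m + 1) * (r + 2) / (r + 3)"
      using r by (intro divide_right_mono mult_right_mono) linarith+
    moreover have "soules_norm q (m + 1) = (r + 4) * (r + 3)"
      using step.hyps by (auto simp: soules_norm_def r_def add.commute)
    then have "soules_partial_sum q \<mu> (m + 2) =
        soules_partial_sum q \<mu> (m + 1) + \<mu> (m + 1) / ((r + 4) * (r + 3))"
      by (simp add: soules_partial_sum_def)
    moreover have "\<mu> (m + 1) / ((r + 4) * (r + 3)) + \<mu> (m + 1) * (r + 2) / (r + 3) =
        \<mu> (m + 1) * (r + 3) / (r + 4)"
      using r by (simp add: divide_simps) (simp add: algebra_simps)
    moreover have q: "Suc m + 1 = m + 2" "real q + 3 - real (Suc m) = r + 2"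
        "real q + 4 - real (Suc m) = r + 3" "real q + 3 - real m = r + 3" "real q + 4 - real m = r + 4"
      by (simp_all add: r_def)
    ultimately show ?case
      using step.IH unfolding q by linarith
  qed
qed

lemma soules_entry_nonneg:
  assumes dec: "\<And>k. k < q + 3 \<Longrightarrow> \<mu> (Suc k) \<le> \<mu> k"
    and diag: "soules_partial_sum q \<mu> (q + 1) + (\<mu> (q + 1) + \<mu> (q + 2) + \<mu> (q + 3)) / 4 \<ge> 0"
    and off: "soules_partial_sum q \<mu> (q + 1) + (- \<mu> (q + 1) - \<mu> (q + 2) + \<mu> (q + 3)) / 4 \<ge> 0"
    and ij: "i \<le> j" "j < q + 4"
  shows "(\<Sum>k<q + 4. \<mu> k / soules_norm q k * (soules q k i * soules q k j)) \<ge> 0"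
proof (cases "i < q")
  case True
  then show ?thesis
    using soules_entry_first[OF True ij, of \<mu>] soules_partial_sum_ge[of q \<mu> i, OF dec]
      soules_diag_ge[of q \<mu> i, OF dec] diag
    by auto
next
  case False
  have "\<mu> (q + 2) \<le> \<mu> (q + 1)" "\<mu> (q + 3) \<le> \<mu> (q + 2)"
    using dec[of "q + 1"] dec[of "q + 2"] by (auto simp: numeral_eq_Suc)
  moreover have "i = q \<or> i = q + 1 \<or> i = q + 2 \<or> i = q + 3"
      "j = q \<or> j = q + 1 \<or> j = q + 2 \<or> j = q + 3"
    using False ij by auto
  moreover have "q \<le> i" "i < q + 4" "q \<le> j"
    using False ij by auto
  ultimately show ?thesis
    unfolding soules_entry_last[OF \<open>q \<le> i\<close> \<open>i < q + 4\<close> \<open>q \<le> j\<close> ij(2)] using diag off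
    by (elim disjE; hypsubst; simp add: soules_def; argo?)
qed

section \<open>Existence of the doubly stochastic matrix\<close>

theorem theorem2p7:
  fixes n :: nat and lam :: "nat \<Rightarrow> real"
  assumes "n \<ge> 5"
    and "1 \<ge> lam 2"
    and "\<And>k. 2 \<le> k \<Longrightarrow> k < n \<Longrightarrow> lam k \<ge> lam (k + 1)"
    and "lam n \<ge> -1"
    and "1 + (\<Sum>k=2..n. lam k) \<ge> 0"
    and "1 / real n
         + (\<Sum>k=2..n-3. lam k / ((real n - real k + 2) * (real n - real k + 1)))
         + lam (n-2) / 4 + lam (n-1) / 4 + lam n / 4 \<ge> 0"
    and "1 / real n
         + (\<Sum>k=2..n-3. lam k / ((real n - real k + 2) * (real n - real k + 1)))
         - lam (n-2) / 4 - lam (n-1) / 4 + lam n / 4 \<ge> 0"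
  shows "\<exists>D. doubly_stochastic n D \<and> symmetric_matrix D \<and>
           eigenvalue_mset D = {#1#} + image_mset lam (mset_set {2..n})"
proof -
  define q where "q = n - 4"
  have n: "n = q + 4" using assms(1) by (simp add: q_def)
  define \<mu> where "\<mu> k = (if k = 0 then 1 else lam (k + 1))" for k
  define D where "D = spectral_mat n \<mu> (soules q) (soules_norm q)"
  have dec: "\<mu> (Suc k) \<le> \<mu> k" if "k < q + 3" for k
    using assms(2) assms(3)[of "k + 1"] that by (auto simp: \<mu>_def n numeral_2_eq_2)
  have "soules_partial_sum q \<mu> (q + 1) =
      1 / real n + (\<Sum>k<q. \<mu> (Suc k) / soules_norm q (Suc k))"
    unfolding soules_partial_sum_def
    by (simp add: sum.lessThan_Suc_shift soules_norm_def \<mu>_def n del: sum.lessThan_Suc)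
  also have "(\<Sum>k<q. \<mu> (Suc k) / soules_norm q (Suc k)) =
      (\<Sum>k=2..n-3. lam k / ((real n - real k + 2) * (real n - real k + 1)))"
    by (rule sum.reindex_bij_witness[of _ "\<lambda>k. k - 2" "\<lambda>k. k + 2"])
      (auto simp: n \<mu>_def soules_norm_def algebra_simps)
  finally have T: "soules_partial_sum q \<mu> (q + 1) = 1 / real n +
      (\<Sum>k=2..n-3. lam k / ((real n - real k + 2) * (real n - real k + 1)))" .
  have \<mu>_last: "\<mu> (q + 1) = lam (n - 2)" "\<mu> (q + 2) = lam (n - 1)" "\<mu> (q + 3) = lam n"
    by (simp_all add: \<mu>_def n numeral_eq_Suc)
  have "soules_partial_sum q \<mu> (q + 1) + (\<mu> (q + 1) + \<mu> (q + 2) + \<mu> (q + 3)) / 4 \<ge> 0"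
    unfolding T \<mu>_last using assms(6) by argo
  moreover have "soules_partial_sum q \<mu> (q + 1) + (- \<mu> (q + 1) - \<mu> (q + 2) + \<mu> (q + 3)) / 4 \<ge> 0"
    unfolding T \<mu>_last using assms(7) by argo
  ultimately have upper: "D $$ (i, j) \<ge> 0" if "i \<le> j" "j < n" for i j
    using soules_entry_nonneg[of q \<mu> i j, OF dec] that
    by (simp add: D_def spectral_mat_index n)
  have sym: "D $$ (j, i) = D $$ (i, j)" if "i < n" "j < n" for i j
    using that by (simp add: D_def spectral_mat_sym)
  have nonneg: "D $$ (i, j) \<ge> 0" if "i < n" "j < n" for i j
    using upper[of i j] upper[of j i] sym[of i j] that by (cases "i \<le> j") auto
  have row: "(\<Sum>j<n. D $$ (i, j)) = 1" if "i < n" for i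
    unfolding D_def
    by (rule spectral_mat_row_sum)
      (use that sum_soules[of _ q] in \<open>auto simp: n soules_norm_def soules_def \<mu>_def\<close>)
  moreover have "(\<Sum>i<n. D $$ (i, j)) = 1" if "j < n" for j
    using row[OF that] sym that by simp
  ultimately have "doubly_stochastic n D"
    using nonneg by (simp add: doubly_stochastic_def D_def)
  moreover have "symmetric_matrix D"
    by (simp add: D_def symmetric_spectral_mat)
  moreover have "eigenvalue_mset D = {#1#} + image_mset lam (mset_set {2..n})"
  proof -
    have "eigenvalue_mset D = image_mset \<mu> (mset_set {..<n})"
      unfolding eigenvalue_mset_def D_def
      by (rule proots_char_poly_spectral_mat) (simp_all add: n soules_orthogonal soules_norm_nonzero)
    also have "{..<n} = insert 0 (Suc ` {..<q + 3})"
      using lessThan_Suc_eq_insert_0[of "q + 3"] by (simp add: n numeral_eq_Suc)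
    also have "image_mset \<mu> (mset_set \<dots>) =
        {#1#} + image_mset (\<lambda>k. lam (k + 2)) (mset_set {..<q + 3})"
      by (simp add: image_mset_mset_set[symmetric] multiset.map_comp o_def \<mu>_def)
    also have "{2..n} = (\<lambda>k. k + 2) ` {..<q + 3}"
    proof (intro equalityI subsetI)
      fix k assume "k \<in> {2..n}"
      then show "k \<in> (\<lambda>k. k + 2) ` {..<q + 3}"
        by (intro image_eqI[of _ _ "k - 2"]) (auto simp: n)
    qed (auto simp: n)
    then have "mset_set {2..n} = image_mset (\<lambda>k. k + 2) (mset_set {..<q + 3})"
      by (simp add: image_mset_mset_set inj_on_def)
    then have "image_mset (\<lambda>k. lam (k + 2)) (mset_set {..<q + 3}) =
        image_mset lam (mset_set {2..n})"
      by (simp add: multiset.map_comp o_def)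
    finally show ?thesis .
  qed
  ultimately show ?thesis by blast
qed

end
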